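(* Let $F$ be a commutative field, $1\le h\le n-1$, and let $\chi:\Gamma(n,h-1,F)\to\mathrm{PG}(n,F)^*$ be a linear mapping with non-empty domain satisfying the null property $U\subseteq U^\chi$ for all $U\in\mathbb D(\chi)$. Then there is a unique linear complex $K$ of $h$-subspaces of $\mathrm{PG}(n,F)$ such that $\chi=\uparrow K$.
   Context: A $d$-subspace is a projective subspace of dimension $d$. Grassmannian $\Gamma(n,k,F)$: points are $k$-subspaces, lines are pencils $\{X:U\subset X\subset W,\dim X=k\}$ with $\dim U=k-1$, $\dim W=k+1$. $\mathrm{PG}(n,F)^*$ is the dual projective space (points = hyperplanes). A partial map $\chi$ has domain $\mathbb D(\chi)$, exceptional set $\mathbb A(\chi)$ (the complement), and $\phi^\chi=\{X^\chi:X\in\phi\cap\mathbb D(\chi)\}$; it is a linear mapping if for each line $\ell$ exactly one holds: (i) $\ell^\chi$ is a line and $\chi$ maps $\ell$ bijectively onto it; (ii) $\ell^\chi$ is one point and $|\ell\cap\mathbb A(\chi)|=1$; (iii) $\ell\subseteq\mathbb A(\chi)$. A linear complex of $h$-subspaces is the set of $h$-subspaces whose Plücker image ($F(v_0\wedge\cdots\wedge v_h)$ for a basis $v_0,\dots,v_h$) lies in a fixed hyperplane of $\mathbb P(\bigwedge^{h+1}F^{n+1})$. For such $K$, an $(h-1)$-subspace $U$ is singular if all $h$-subspaces through $U$ lie in $K$; otherwise there is a unique hyperplane $E$ (polar hyperplane) such that an $h$-subspace $X\supseteq U$ is in $K$ iff $X\subseteq E$. $\uparrow K$ is the partial map with exceptional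 set the singular $(h-1)$-subspaces, sending each non-singular $U$ to its polar hyperplane. *)

theory Defs
  imports "HOL-Analysis.Analysis"
begin

text \<open>The projective space PG(n,F) is modelled on the vector space F^(n+1) = 'a^'n with
  n + 1 = CARD('n). A projective d-subspace is a linear subspace of vector dimension d+1.
  Throughout, subspaces are indexed by their VECTOR dimension k (= projective dimension + 1).\<close>

definition vsubs :: "nat \<Rightarrow> ('a::field ^ 'n) set set" where
  "vsubs k = {X. vec.subspace X \<and> vec.dim X = k}"

definition pencil :: "('a::field ^ 'n) set \<Rightarrow> ('a ^ 'n) set \<Rightarrow> nat \<Rightarrow> ('a ^ 'n) set set" where
  "pencil U W k = {X \<in> vsubs k. U \<subseteq> X \<and> X \<subseteq> W}"

definition grass_lines :: "nat \<Rightarrow> ('a::field ^ 'n) set set set" where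
  "grass_lines k = {pencil U W k | U W. vec.subspace U \<and> vec.subspace W \<and>
      vec.dim U = k - 1 \<and> vec.dim W = k + 1 \<and> U \<subseteq> W}"

definition pdim :: "'n::finite itself \<Rightarrow> nat" where
  "pdim _ = CARD('n) - 1"

text \<open>Dual space PG(n,F)^*: points are hyperplanes (vector dimension n), lines are the
  pencils of hyperplanes through a fixed (n-2)-subspace, i.e. the Grassmannian lines with k = n.\<close>
definition dual_points :: "('a::field ^ 'n::finite) set set" where
  "dual_points = vsubs (pdim TYPE('n))"

definition dual_lines :: "('a::field ^ 'n::finite) set set set" where
  "dual_lines = grass_lines (pdim TYPE('n))"

definition pimage :: "('b \<Rightarrow> 'c option) \<Rightarrow> 'b set \<Rightarrow> 'c set" where
  "pimage chi S = {Y. \<exists>X\<in>S. chi X = Some Y}"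

definition linear_mapping :: "nat \<Rightarrow> (('a::field ^ 'n::finite) set \<Rightarrow> ('a ^ 'n) set option) \<Rightarrow> bool" where
  "linear_mapping k chi \<longleftrightarrow>
     dom chi \<subseteq> vsubs k \<and> ran chi \<subseteq> dual_points \<and>
     (\<forall>l \<in> grass_lines k.
        (let A = vsubs k - dom chi;
             c1 = (pimage chi l \<in> dual_lines \<and> l \<subseteq> dom chi \<and>
                   bij_betw (the \<circ> chi) l (pimage chi l));
             c2 = (card (pimage chi l) = 1 \<and> finite (pimage chi l) \<and> card (l \<inter> A) = 1 \<and> finite (l \<inter> A));
             c3 = (l \<subseteq> A)
         in (c1 \<and> \<not> c2 \<and> \<not> c3) \<or> (\<not> c1 \<and> c2 \<and> \<not> c3) \<or> (\<not> c1 \<and> \<not> c2 \<and> c3)))"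

text \<open>Alternating m-linear forms on F^(n+1); arguments are given as a function on the
  indices 0..m-1 (values at other indices are irrelevant).\<close>
definition alt_form :: "nat \<Rightarrow> ((nat \<Rightarrow> 'a::field ^ 'n) \<Rightarrow> 'a) \<Rightarrow> bool" where
  "alt_form m w \<longleftrightarrow>
     (\<forall>v u. (\<forall>i<m. v i = u i) \<longrightarrow> w v = w u) \<and>
     (\<forall>i<m. \<forall>v c x y. w (v(i := c *s x + y)) = c * w (v(i := x)) + w (v(i := y))) \<and>
     (\<forall>v i j. i < m \<and> j < m \<and> i \<noteq> j \<and> v i = v j \<longrightarrow> w v = 0)"

text \<open>A linear complex of projective h-subspaces (vector dimension h+1): a hyperplane of
  P(\<Lambda>^(h+1) F^(n+1)) is the kernel of a nonzero linear functional on \<Lambda>^(h+1) F^(n+1), i.e. of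
  a nonzero alternating (h+1)-linear form w; the Pluecker point F(v_0 \<and> ... \<and> v_h) lies in it
  iff w(v_0,...,v_h) = 0, for a basis v_0..v_h of X.\<close>
definition linear_complex :: "nat \<Rightarrow> ('a::field ^ 'n) set set \<Rightarrow> bool" where
  "linear_complex h K \<longleftrightarrow>
     (\<exists>w. alt_form (h + 1) w \<and> (\<exists>v. w v \<noteq> 0) \<and>
        K = {X \<in> vsubs (h + 1). \<exists>v. inj_on v {..<h+1} \<and> vec.independent (v ` {..<h+1}) \<and>
                 vec.span (v ` {..<h+1}) = X \<and> w v = 0})"

definition singular :: "nat \<Rightarrow> ('a::field ^ 'n) set set \<Rightarrow> ('a ^ 'n) set \<Rightarrow> bool" where
  "singular h K U \<longleftrightarrow> (\<forall>X \<in> vsubs (h + 1). U \<subseteq> X \<longrightarrow> X \<in> K)"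

definition polar :: "nat \<Rightarrow> ('a::field ^ 'n::finite) set set \<Rightarrow> ('a ^ 'n) set \<Rightarrow> ('a ^ 'n) set" where
  "polar h K U = (THE E. E \<in> dual_points \<and> (\<forall>X \<in> vsubs (h + 1). U \<subseteq> X \<longrightarrow> (X \<in> K \<longleftrightarrow> X \<subseteq> E)))"

definition up_complex :: "nat \<Rightarrow> ('a::field ^ 'n::finite) set set \<Rightarrow> ('a ^ 'n) set \<Rightarrow> ('a ^ 'n) set option" where
  "up_complex h K U = (if U \<in> vsubs h \<and> \<not> singular h K U then Some (polar h K U) else None)"

end

theory Submission
  imports Defs
begin

text \<open>
  The (h+1)-dimensional subspaces X split into two classes: by linearity on pencils and the null
  property, either every h-dimensional U in X is non-exceptional with X not contained in its image,
  or every such U is exceptional or has X inside its image. The second class is the only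
  candidate for K. Written in terms of spanning (h+1)-tuples it is a predicate Z such that, with
  all but one argument fixed, Z holds exactly on the kernel of a linear form, and Z holds on tuples
  with a repetition.

  Any such Z is the zero set of an alternating form. By induction each tail predicate Z(p, -) comes
  from an alternating form W p, unique up to a scalar, and the scalars have to be chosen so that W
  becomes linear in p. For fixed remaining arguments
  W p q * W q r * W r p = - (W q p * W r q * W p r); this cocycle condition makes the normalisation
  against one fixed vector b consistent, provided the three factors are simultaneously nonzero
  somewhere. That holds as soon as the field has three elements, and over the field with
  two elements there is no scalar to choose.
\<close>

section \<open>Forms on tuples\<close>

definition linear_form :: "('a::field ^ 'n \<Rightarrow> 'a) \<Rightarrow> bool" where
  "linear_form f \<longleftrightarrow> (\<forall>c x y. f (c *s x + y) = c * f x + f y)"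

text \<open>Tuples are lists, so that fixing the first argument is \<open>w (p # v)\<close> and
  inductions on the arity peel off the head. Only lists of length \<open>m\<close> are
  constrained.\<close>

definition multilinear :: "nat \<Rightarrow> (('a::field ^ 'n) list \<Rightarrow> 'a) \<Rightarrow> bool" where
  "multilinear m w \<longleftrightarrow>
     (\<forall>xs ys. length xs + length ys + 1 = m \<longrightarrow> linear_form (\<lambda>x. w (xs @ x # ys)))"

definition alternating :: "nat \<Rightarrow> (('a::field ^ 'n) list \<Rightarrow> 'a) \<Rightarrow> bool" where
  "alternating m w \<longleftrightarrow> multilinear m w \<and>
     (\<forall>xs x ys zs. length xs + length ys + length zs + 2 = m \<longrightarrow> w (xs @ x # ys @ x # zs) = 0)"

text \<open>The trace that an alternating form leaves on its zero set. Each slot gets its own linear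
  form, possibly zero, and nothing ties together the choices for different slots or different fixed
  arguments.\<close>

definition alternating_zeros :: "nat \<Rightarrow> (('a::field ^ 'n) list \<Rightarrow> bool) \<Rightarrow> bool" where
  "alternating_zeros m Z \<longleftrightarrow>
     (\<forall>xs ys. length xs + length ys + 1 = m \<longrightarrow>
        (\<exists>f. linear_form f \<and> (\<forall>x. Z (xs @ x # ys) \<longleftrightarrow> f x = 0))) \<and>
     (\<forall>xs x ys zs. length xs + length ys + length zs + 2 = m \<longrightarrow> Z (xs @ x # ys @ x # zs))"

lemma linear_formD:
  assumes "linear_form f"
  shows linear_form_axpy: "f (c *s x + y) = c * f x + f y"
    and linear_form_add: "f (x + y) = f x + f y"
    and linear_form_zero: "f 0 = 0"
    and linear_form_scale: "f (c *s x) = c * f x"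
    and linear_form_diff: "f (x - y) = f x - f y"
proof -
  have l: "f (c *s x + y) = c * f x + f y" for c x y
    using assms by (simp add: linear_form_def)
  show "f (c *s x + y) = c * f x + f y" by (rule l)
  show "f (x + y) = f x + f y" using l[of 1 x y] by simp
  show z: "f 0 = 0" using l[of "-1" 0 0] by simp
  show "f (c *s x) = c * f x" using l[of c x 0] z by simp
  show "f (x - y) = f x - f y" using l[of "-1" y x] by (simp add: vector_sneg_minus1[symmetric])
qed

lemma linear_form_diff_scale: "linear_form f \<Longrightarrow> f (x - c *s y) = f x - c * f y"
  by (simp add: linear_form_diff linear_form_scale)

section \<open>Kernels of linear forms and vectors outside given subspaces\<close>

lemma subspace_kernel: "linear_form f \<Longrightarrow> vec.subspace {x. f x = 0}"
  by (rule vec.subspaceI) (simp_all add: linear_formD)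

text \<open>A zero \<open>z\<close> of \<open>f\<close> outside \<open>R\<close> moves
  \<open>x\<close> in \<open>R\<close> to \<open>x + z\<close> outside \<open>R\<close>, where zeros
  agree. If there is no such \<open>z\<close>, then \<open>g\<close> has no zero outside
  \<open>R\<close> either; but for nonzero \<open>g x\<close>, subtracting a multiple of
  \<open>x\<close> from \<open>y\<close> produces one.\<close>

lemma zeros_agree_outside_subspace:
  assumes f: "linear_form f" and g: "linear_form g"
    and R: "vec.subspace R" and y: "y \<notin> R"
    and agree: "\<And>x. x \<notin> R \<Longrightarrow> f x = 0 \<longleftrightarrow> g x = 0"
    and fx: "f x = 0"
  shows "g x = 0"
proof (cases "x \<in> R")
  case False
  then show ?thesis using agree fx by blast
next
  case xR: True
  show ?thesis
  proof (cases "\<exists>z. z \<notin> R \<and> f z = 0")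
    case True
    then obtain z where z: "z \<notin> R" "f z = 0" by blast
    have "x + z \<notin> R"
      using vec.subspace_diff[OF R _ xR, of "x + z"] z by auto
    moreover have "f (x + z) = 0" using z fx by (simp add: linear_form_add[OF f])
    ultimately have "g (x + z) = 0" "g z = 0"
      using agree z by blast+
    then show ?thesis using linear_form_add[OF g, of x z] by simp
  next
    case no: False
    show ?thesis
    proof (rule ccontr)
      assume gx: "g x \<noteq> 0"
      let ?z = "y - (g y / g x) *s x"
      have "?z \<notin> R"
        using vec.subspace_add[OF R _ vec.subspace_scale[OF R xR], of ?z "g y / g x"] y by auto
      moreover have "g ?z = 0" using gx by (simp add: linear_form_diff_scale[OF g])
      ultimately show False using no agree by blast
    qed
  qed
qed

lemma avoid_two_subspaces:
  fixes S\<^sub>1 S\<^sub>2 :: "('a::field ^ 'n) set"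
  assumes "vec.subspace S\<^sub>1" "vec.subspace S\<^sub>2" "x\<^sub>1 \<notin> S\<^sub>1" "x\<^sub>2 \<notin> S\<^sub>2"
  obtains x where "x \<notin> S\<^sub>1" "x \<notin> S\<^sub>2"
proof (cases "x\<^sub>1 \<in> S\<^sub>2 \<and> x\<^sub>2 \<in> S\<^sub>1")
  case True
  then have "x\<^sub>1 + x\<^sub>2 \<notin> S\<^sub>1" "x\<^sub>1 + x\<^sub>2 \<notin> S\<^sub>2"
    using assms vec.subspace_diff[of S\<^sub>1 "x\<^sub>1 + x\<^sub>2" x\<^sub>2] vec.subspace_diff[of S\<^sub>2 "x\<^sub>1 + x\<^sub>2" x\<^sub>1] by auto
  then show ?thesis by (rule that)
next
  case False
  then show ?thesis using assms that by blast
qed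

text \<open>For \<open>z\<close> outside the first two subspaces but inside the third, all
  \<open>x\<^sub>3 + c *s z\<close> avoid the third, and each of the first two contains at most one
  of them. So one of the scalars 0, 1, \<open>e\<close> works. Over two elements three proper
  subspaces can cover the space.\<close>

lemma avoid_three_subspaces:
  fixes S\<^sub>1 S\<^sub>2 S\<^sub>3 :: "('a::field ^ 'n) set"
  assumes S: "vec.subspace S\<^sub>1" "vec.subspace S\<^sub>2" "vec.subspace S\<^sub>3"
    and x: "x\<^sub>1 \<notin> S\<^sub>1" "x\<^sub>2 \<notin> S\<^sub>2" "x\<^sub>3 \<notin> S\<^sub>3"
    and e: "e \<noteq> (0::'a)" "e \<noteq> 1"
  obtains x where "x \<notin> S\<^sub>1" "x \<notin> S\<^sub>2" "x \<notin> S\<^sub>3"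
proof -
  obtain z where z: "z \<notin> S\<^sub>1" "z \<notin> S\<^sub>2"
    using avoid_two_subspaces S x by metis
  show ?thesis
  proof (cases "z \<in> S\<^sub>3")
    case False
    then show ?thesis using z that by blast
  next
    case zS: True
    have 3: "x\<^sub>3 + c *s z \<notin> S\<^sub>3" for c
      using vec.subspace_diff[OF S(3) _ vec.subspace_scale[OF S(3) zS], of "x\<^sub>3 + c *s z" c] x by auto
    have uniq: "c = d" if "vec.subspace S" "z \<notin> S" "x\<^sub>3 + c *s z \<in> S" "x\<^sub>3 + d *s z \<in> S" for c d S
    proof (rule ccontr)
      assume "c \<noteq> d"
      have "(c - d) *s z \<in> S"
        using vec.subspace_diff[OF that(1,3,4)] by (simp add: vector_sub_rdistrib)
      then have "inverse (c - d) *s ((c - d) *s z) \<in> S"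
        using vec.subspace_scale that(1) by blast
      then show False using \<open>c \<noteq> d\<close> that(2) by (simp add: vector_smult_assoc del: vector_sub_rdistrib)
    qed
    have "\<exists>c. x\<^sub>3 + c *s z \<notin> S\<^sub>1 \<and> x\<^sub>3 + c *s z \<notin> S\<^sub>2"
    proof (rule ccontr)
      assume "\<not> ?thesis"
      then have c: "x\<^sub>3 + c *s z \<in> S\<^sub>1 \<or> x\<^sub>3 + c *s z \<in> S\<^sub>2" for c by blast
      show False
        using c[of 0] c[of 1] c[of e] uniq[OF S(1) z(1)] uniq[OF S(2) z(2)] e zero_neq_one by metis
    qed
    then show ?thesis using 3 that by blast
  qed
qed

section \<open>Multilinear and alternating forms with the first argument fixed\<close>

lemma multilinear_head: "multilinear (Suc m) w \<Longrightarrow> length v = m \<Longrightarrow> linear_form (\<lambda>x. w (x # v))"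
  unfolding multilinear_def by (drule spec[where x = "[]"]) simp

lemma multilinear_tail:
  assumes "multilinear (Suc m) w"
  shows "multilinear m (\<lambda>v. w (p # v))"
  unfolding multilinear_def
proof (intro allI impI)
  fix xs ys :: "('a ^ 'b) list"
  assume "length xs + length ys + 1 = m"
  then have "length (p # xs) + length ys + 1 = Suc m" by simp
  then have "linear_form (\<lambda>x. w ((p # xs) @ x # ys))"
    using assms unfolding multilinear_def by blast
  then show "linear_form (\<lambda>x. w (p # xs @ x # ys))" by simp
qed

lemma alternating_tail:
  assumes "alternating (Suc m) w"
  shows "alternating m (\<lambda>v. w (p # v))"
  unfolding alternating_def
proof (intro conjI allI impI)
  show "multilinear m (\<lambda>v. w (p # v))"
    using assms by (simp add: alternating_def multilinear_tail)
  fix xs ys zs :: "('a ^ 'b) list" and x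
  assume "length xs + length ys + length zs + 2 = m"
  then have "length (p # xs) + length ys + length zs + 2 = Suc m" by simp
  then have "w ((p # xs) @ x # ys @ x # zs) = 0"
    using assms unfolding alternating_def by blast
  then show "w (p # xs @ x # ys @ x # zs) = 0" by simp
qed

lemma subspace_left_radical:
  assumes "multilinear (Suc m) w"
  shows "vec.subspace {p. \<forall>v. length v = m \<longrightarrow> w (p # v) = 0}"
  by (rule vec.subspaceI) (auto simp: linear_formD[OF multilinear_head[OF assms]])

lemma alternating_swap:
  assumes w: "alternating m w" and len: "length xs + length ys + length zs + 2 = m"
  shows "w (xs @ x # ys @ y # zs) = - w (xs @ y # ys @ x # zs)"
proof -
  have l1: "linear_form (\<lambda>x. w (xs @ x # ys @ y # zs))" for y
    using w len unfolding alternating_def multilinear_def by auto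
  have l2: "linear_form (\<lambda>y. w (xs @ x # ys @ y # zs))" for x
  proof -
    have "length (xs @ x # ys) + length zs + 1 = m" using len by simp
    then have "linear_form (\<lambda>y. w ((xs @ x # ys) @ y # zs))"
      using w unfolding alternating_def multilinear_def by blast
    then show ?thesis by simp
  qed
  have d: "w (xs @ x # ys @ x # zs) = 0" for x
    using w len unfolding alternating_def by blast
  have "0 = w (xs @ (x + y) # ys @ (x + y) # zs)" using d by simp
  also have "\<dots> = w (xs @ x # ys @ y # zs) + w (xs @ y # ys @ x # zs)"
    by (simp only: linear_form_add[OF l1] linear_form_add[OF l2]) (simp add: d)
  finally show ?thesis by (simp add: eq_neg_iff_add_eq_0)
qed

text \<open>A repetition away from the head lies within a tail form; one involving the head is moved
  to the first two places by a swap inside the tail. Only the diagonal of the first two slots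
  remains.\<close>

lemma alternating_Cons:
  assumes tail: "\<And>p. alternating (Suc m) (\<lambda>v. w (p # v))"
    and head: "\<And>v. length v = Suc m \<Longrightarrow> linear_form (\<lambda>p. w (p # v))"
    and diag: "\<And>p v. length v = m \<Longrightarrow> w (p # p # v) = 0"
  shows "alternating (Suc (Suc m)) w"
  unfolding alternating_def multilinear_def
proof (intro conjI allI impI)
  fix xs ys :: "('a ^ 'b) list"
  assume "length xs + length ys + 1 = Suc (Suc m)"
  then show "linear_form (\<lambda>x. w (xs @ x # ys))"
    using head tail by (cases xs) (auto simp: alternating_def multilinear_def)
next
  fix xs ys zs :: "('a ^ 'b) list" and x
  assume len: "length xs + length ys + length zs + 2 = Suc (Suc m)"
  show "w (xs @ x # ys @ x # zs) = 0"
  proof (cases xs)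
    case (Cons p xs')
    then show ?thesis using tail[of p] len by (auto simp: alternating_def)
  next
    case Nil
    show ?thesis
    proof (cases ys)
      case Nil
      then show ?thesis using diag len \<open>xs = []\<close> by simp
    next
      case (Cons y ys')
      then have "w (x # [] @ y # ys' @ x # zs) = - w (x # [] @ x # ys' @ y # zs)"
        using len \<open>xs = []\<close> by (intro alternating_swap[OF tail]) auto
      then show ?thesis using diag len Cons \<open>xs = []\<close> by simp
    qed
  qed
qed

lemma alternating_scale: "alternating m w \<Longrightarrow> alternating m (\<lambda>v. c * w v)"
  by (simp add: alternating_def multilinear_def linear_form_def algebra_simps)

lemma alternating_diff: "alternating m w \<Longrightarrow> alternating m w' \<Longrightarrow> alternating m (\<lambda>v. w v - w' v)"
  by (simp add: alternating_def multilinear_def linear_form_def algebra_simps)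

text \<open>By induction every head \<open>p\<close> has its own scalar \<open>c p\<close>;
  additivity in the head then shows that a single scalar \<open>c b\<close> serves for all of
  them.\<close>

lemma multilinear_proportional:
  assumes "multilinear m w" "multilinear m w'"
    and "\<And>v. length v = m \<Longrightarrow> w v = 0 \<longleftrightarrow> w' v = 0"
  shows "\<exists>c. c \<noteq> 0 \<and> (\<forall>v. length v = m \<longrightarrow> w' v = c * w v)"
  using assms
proof (induction m arbitrary: w w')
  case 0
  then show ?case
    by (intro exI[of _ "if w [] = 0 then 1 else w' [] / w []"]) auto
next
  case (Suc m)
  note lin = multilinear_head[OF Suc.prems(1)] and lin' = multilinear_head[OF Suc.prems(2)]
  have "\<exists>c. c \<noteq> 0 \<and> (\<forall>v. length v = m \<longrightarrow> w' (p # v) = c * w (p # v))" for p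
    by (rule Suc.IH) (use Suc.prems in \<open>auto intro: multilinear_tail\<close>)
  then obtain c where c0: "\<And>p. c p \<noteq> 0"
    and c: "\<And>p v. length v = m \<Longrightarrow> w' (p # v) = c p * w (p # v)"
    by metis
  show ?case
  proof (cases "\<exists>b u. length u = m \<and> w (b # u) \<noteq> 0")
    case False
    then have "w v = 0 \<and> w' v = 0" if "length v = Suc m" for v
      using that c by (cases v) auto
    then show ?thesis by (intro exI[of _ 1]) auto
  next
    case True
    then obtain b u where u: "length u = m" "w (b # u) \<noteq> 0" by blast
    have "w' (p # v) = c b * w (p # v)" if v: "length v = m" for p v
    proof -
      \<comment> \<open>Obtained by computing \<open>w' ((p + b) # t)\<close> twice, with the scalar
        of \<open>p + b\<close> and with those of \<open>p\<close> and \<open>b\<close>.\<close>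
      have sum: "(c p - c (p + b)) * w (p # t) = (c (p + b) - c b) * w (b # t)" if t: "length t = m" for t
        using c[OF t, of "p + b"] c[OF t, of p] c[OF t, of b]
        by (simp add: linear_form_add[OF lin[OF t]] linear_form_add[OF lin'[OF t]] algebra_simps)
      show ?thesis
      proof (cases "c p = c (p + b)")
        case True
        then have "c p = c b" using sum[OF u(1)] u(2) by simp
        then show ?thesis using c[OF v] by simp
      next
        case False
        \<comment> \<open>Here \<open>w (p # t)\<close> is \<open>a * w (b # t)\<close> for every
          \<open>t\<close>, so \<open>p - a *s b\<close> annihilates \<open>w\<close> and, zeros
          being shared, also \<open>w'\<close>. Thus \<open>w'\<close> has the same ratio
          \<open>a\<close>, and the scalar of \<open>b\<close> works for \<open>p\<close>.\<close>
        define a where "a = (c (p + b) - c b) / (c p - c (p + b))"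
        have scaled: "w (p # t) = a * w (b # t)" if "length t = m" for t
          using sum[OF that] False by (simp add: a_def field_simps)
        have "w ((p - a *s b) # v) = 0"
          using scaled[OF v] linear_form_diff_scale[OF lin[OF v]] by simp
        then have "w' ((p - a *s b) # v) = 0" using c[OF v] by simp
        then have "w' (p # v) = a * w' (b # v)"
          using linear_form_diff_scale[OF lin'[OF v]] by simp
        then show ?thesis using c[OF v, of b] scaled[OF v] by simp
      qed
    qed
    then have "w' v = c b * w v" if "length v = Suc m" for v
      using that by (cases v) auto
    then show ?thesis using c0 by blast
  qed
qed

text \<open>For each form the heads that annihilate it make up a proper subspace; a head outside all
  three reduces the arity.\<close>

lemma multilinear_common_nonzero:
  fixes w\<^sub>1 w\<^sub>2 w\<^sub>3 :: "('a::field ^ 'n) list \<Rightarrow> 'a"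
  assumes "e \<noteq> (0::'a)" "e \<noteq> 1"
    and "multilinear m w\<^sub>1" "multilinear m w\<^sub>2" "multilinear m w\<^sub>3"
    and "\<exists>v. length v = m \<and> w\<^sub>1 v \<noteq> 0" "\<exists>v. length v = m \<and> w\<^sub>2 v \<noteq> 0"
      "\<exists>v. length v = m \<and> w\<^sub>3 v \<noteq> 0"
  shows "\<exists>v. length v = m \<and> w\<^sub>1 v \<noteq> 0 \<and> w\<^sub>2 v \<noteq> 0 \<and> w\<^sub>3 v \<noteq> 0"
  using assms
proof (induction m arbitrary: w\<^sub>1 w\<^sub>2 w\<^sub>3)
  case 0
  then show ?case by auto
next
  case (Suc m)
  let ?S = "\<lambda>w. {p. \<forall>v. length v = m \<longrightarrow> w (p # v) = 0}"
  have ex: "\<exists>p. p \<notin> ?S w" if "\<exists>v. length v = Suc m \<and> w v \<noteq> 0" for w :: "('a ^ 'n) list \<Rightarrow> 'a"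
    using that by (auto simp: length_Suc_conv)
  obtain p\<^sub>1 where 1: "p\<^sub>1 \<notin> ?S w\<^sub>1" using ex[OF Suc.prems(6)] by blast
  obtain p\<^sub>2 where 2: "p\<^sub>2 \<notin> ?S w\<^sub>2" using ex[OF Suc.prems(7)] by blast
  obtain p\<^sub>3 where 3: "p\<^sub>3 \<notin> ?S w\<^sub>3" using ex[OF Suc.prems(8)] by blast
  obtain p where "p \<notin> ?S w\<^sub>1" "p \<notin> ?S w\<^sub>2" "p \<notin> ?S w\<^sub>3"
    using avoid_three_subspaces[OF Suc.prems(3-5)[THEN subspace_left_radical] 1 2 3 Suc.prems(1,2)]
    by blast
  then have "\<exists>v. length v = m \<and> w\<^sub>1 (p # v) \<noteq> 0 \<and> w\<^sub>2 (p # v) \<noteq> 0 \<and> w\<^sub>3 (p # v) \<noteq> 0"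
    using Suc.prems by (intro Suc.IH) (auto intro: multilinear_tail)
  then show ?case by (metis length_Cons)
qed

section \<open>Forms from their zero sets\<close>

lemma alternating_zeros_slot:
  assumes "alternating_zeros m Z" "length xs + length ys + 1 = m"
  obtains f where "linear_form f" "\<And>x. Z (xs @ x # ys) \<longleftrightarrow> f x = 0"
  using assms unfolding alternating_zeros_def by metis

lemma alternating_zeros_repeat:
  "alternating_zeros m Z \<Longrightarrow> length xs + length ys + length zs + 2 = m \<Longrightarrow> Z (xs @ x # ys @ x # zs)"
  unfolding alternating_zeros_def by blast

lemma alternating_zeros_tail:
  assumes "alternating_zeros (Suc m) Z"
  shows "alternating_zeros m (\<lambda>v. Z (p # v))"
  unfolding alternating_zeros_def
proof (intro conjI allI impI)
  fix xs ys :: "('a ^ 'b) list"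
  assume "length xs + length ys + 1 = m"
  then have "length (p # xs) + length ys + 1 = Suc m" by simp
  then obtain f where "linear_form f" "\<And>x. Z ((p # xs) @ x # ys) \<longleftrightarrow> f x = 0"
    using alternating_zeros_slot[OF assms] by blast
  then show "\<exists>f. linear_form f \<and> (\<forall>x. Z (p # xs @ x # ys) \<longleftrightarrow> f x = 0)" by auto
next
  fix xs ys zs :: "('a ^ 'b) list" and x
  assume "length xs + length ys + length zs + 2 = m"
  then show "Z (p # xs @ x # ys @ x # zs)"
    using alternating_zeros_repeat[OF assms, of "p # xs" ys zs x] by simp
qed

text \<open>There are no values whose sign could change, so vanishing is carried along (p, q), (p,
  p+q), (q, p+q), (q, p). Each move alters one slot, using a tuple with a repetition in its first
  two places.\<close>

lemma alternating_zeros_swap: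
  assumes Z: "alternating_zeros (Suc (Suc m)) Z" and t: "length t = m" and pq: "Z (p # q # t)"
  shows "Z (q # p # t)"
proof -
  have snd: "\<exists>f. linear_form f \<and> (\<forall>y. Z (x # y # t) \<longleftrightarrow> f y = 0)" for x
    using alternating_zeros_slot[OF Z, of "[x]" t] t by auto
  have fst: "\<exists>f. linear_form f \<and> (\<forall>x. Z (x # y # t) \<longleftrightarrow> f x = 0)" for y
    using alternating_zeros_slot[OF Z, of "[]" "y # t"] t by auto
  have diag: "Z (x # x # t)" for x
    using alternating_zeros_repeat[OF Z, of "[]" "[]" t x] t by simp
  obtain f where "linear_form f" "\<And>y. Z (p # y # t) \<longleftrightarrow> f y = 0" using snd by metis
  then have "Z (p # (p + q) # t)" using pq diag[of p] by (simp add: linear_form_add)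
  moreover obtain f where "linear_form f" "\<And>x. Z (x # (p + q) # t) \<longleftrightarrow> f x = 0" using fst by metis
  ultimately have "Z (q # (p + q) # t)" using diag[of "p + q"] by (simp add: linear_form_add)
  moreover obtain f where "linear_form f" "\<And>y. Z (q # y # t) \<longleftrightarrow> f y = 0" using snd by metis
  ultimately show ?thesis using diag[of q] by (simp add: linear_form_add)
qed

text \<open>Over two elements a linear form is determined by its kernel, so the indicator of the
  complement of \<open>Z\<close> is, in each slot, the form supplied there.\<close>

lemma alternating_zeros_two_element_field:
  fixes Z :: "('a::field ^ 'n) list \<Rightarrow> bool"
  assumes Z: "alternating_zeros m Z" and two: "\<And>e::'a. e = 0 \<or> e = 1"
  shows "alternating m (\<lambda>v. if Z v then 0 else 1)"
  unfolding alternating_def multilinear_def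
proof (intro conjI allI impI)
  fix xs ys :: "('a ^ 'n) list"
  assume "length xs + length ys + 1 = m"
  then obtain f where f: "linear_form f" "\<And>x. Z (xs @ x # ys) \<longleftrightarrow> f x = 0"
    using alternating_zeros_slot[OF Z] by blast
  have "(\<lambda>x. if Z (xs @ x # ys) then 0 else 1) = f"
    using f(2) two by (intro ext) (metis (full_types))
  then show "linear_form (\<lambda>x. if Z (xs @ x # ys) then 0 else 1 :: 'a)" using f by simp
next
  fix xs ys zs :: "('a ^ 'n) list" and x
  assume "length xs + length ys + length zs + 2 = m"
  then show "(if Z (xs @ x # ys @ x # zs) then 0 else 1 :: 'a) = 0"
    using alternating_zeros_repeat[OF Z] by simp
qed

text \<open>The vector s in the proof annihilates p and q by construction, and itself, hence also r.\<close>

lemma three_cycle_identity: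
  fixes f :: "'a::field ^ 'n \<Rightarrow> 'a ^ 'n \<Rightarrow> 'a"
  assumes lin: "\<And>x. linear_form (f x)" and diag: "\<And>x. f x x = 0"
    and sym: "\<And>x y. f x y = 0 \<Longrightarrow> f y x = 0"
  shows "f p q * f q r * f r p = - (f q p * f r q * f p r)"
proof (cases "f p q = 0 \<or> f p r = 0 \<or> f q r = 0")
  case True
  then show ?thesis using sym by auto
next
  case False
  then have nz: "f p q \<noteq> 0" "f q p \<noteq> 0" using sym by blast+
  define s where "s = (- (f q r / f q p)) *s p + ((- (f p r / f p q)) *s q + r)"
  have val: "f x s = - (f q r / f q p) * f x p - f p r / f p q * f x q + f x r" for x
    unfolding s_def linear_form_axpy[OF lin] by simp
  have "f p s = 0" "f q s = 0" unfolding val using nz diag by simp_all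
  then have "f s p = 0" "f s q = 0" by (simp_all add: sym)
  moreover have "f s s = 0" by (rule diag)
  ultimately have "f s r = 0" unfolding s_def linear_form_axpy[OF lin]
    by (metis (no_types, lifting) add_0 mult_zero_right s_def)
  then have "f r s = 0" by (rule sym)
  then have "f q r * f r p / f q p = - (f p r * f r q / f p q)"
    unfolding val by (simp add: diag eq_neg_iff_add_eq_0 algebra_simps neg_eq_iff_add_eq_0)
  then show ?thesis using nz by (simp add: field_simps)
qed

text \<open>Each \<open>W p\<close> is rescaled against \<open>b\<close>. The result is
  antisymmetric in the first two arguments, which turns linearity in the second into linearity in
  the first.\<close>

lemma alternating_zeros_imp_form_step:
  fixes Z :: "('a::field ^ 'n) list \<Rightarrow> bool"
  assumes e: "e \<noteq> (0::'a)" "e \<noteq> 1"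
    and Z: "alternating_zeros (Suc (Suc m)) Z"
    and W: "\<And>p. alternating (Suc m) (W p)"
    and ZW: "\<And>p v. length v = Suc m \<Longrightarrow> Z (p # v) \<longleftrightarrow> W p v = 0"
    and b: "\<exists>v. length v = Suc m \<and> W b v \<noteq> 0"
  shows "\<exists>w. alternating (Suc (Suc m)) w \<and> (\<forall>v. length v = Suc (Suc m) \<longrightarrow> (Z v \<longleftrightarrow> w v = 0))"
proof -
  have ml: "multilinear (Suc m) (W p)" for p using W by (simp add: alternating_def)
  have lin: "linear_form (\<lambda>x. W p (x # t))" if "length t = m" for p t
    using multilinear_head[OF ml that] .
  have ml_tail: "multilinear m (\<lambda>t. W p (q # t))" for p q by (rule multilinear_tail[OF ml])
  have sym: "W q (p # t) = 0 \<longleftrightarrow> W p (q # t) = 0" if t: "length t = m" for p q t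
    using alternating_zeros_swap[OF Z t] ZW[of "_ # t"] t by auto
  have diag: "W p (p # t) = 0" if t: "length t = m" for p t
    using alternating_zeros_repeat[OF Z, of "[]" "[]" t p] ZW[of "p # t" p] t by simp
  \<comment> \<open>On \<open>R\<close> the comparison with \<open>b\<close> is void:
    \<open>W b (p # t)\<close> and \<open>W p (b # t)\<close> vanish for all \<open>t\<close>, so
    \<open>c p\<close> below is an arbitrary nonzero scalar there.\<close>
  define R where "R = {q. \<forall>t. length t = m \<longrightarrow> W b (q # t) = 0}"
  have R: "vec.subspace R" unfolding R_def by (rule subspace_left_radical[OF ml])
  obtain b\<^sub>1 where b\<^sub>1: "b\<^sub>1 \<notin> R"
    using b by (auto simp: R_def length_Suc_conv)
  have shift: "p + b\<^sub>1 \<notin> R" if "p \<in> R" for p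
    using vec.subspace_diff[OF R _ that, of "p + b\<^sub>1"] b\<^sub>1 by auto
  have "\<exists>c. c \<noteq> 0 \<and> (\<forall>t. length t = m \<longrightarrow> W b (p # t) = c * W p (b # t))" for p
    by (rule multilinear_proportional[OF ml_tail ml_tail]) (rule sym)
  then obtain c where c0: "\<And>p. c p \<noteq> 0"
    and c: "\<And>p t. length t = m \<Longrightarrow> W b (p # t) = c p * W p (b # t)"
    by metis
  \<comment> \<open>The sign makes \<open>g p (b # t)\<close> equal to \<open>- W b (p # t)\<close>,
    the desired antisymmetry with \<open>W b\<close> as the form at \<open>b\<close>.\<close>
  define g where "g p v = - c p * W p v" for p v
  have g: "alternating (Suc m) (g p)" for p unfolding g_def by (rule alternating_scale[OF W])
  have g_lin: "linear_form (\<lambda>x. g p (x # t))" if "length t = m" for p t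
    using multilinear_head[OF _ that] g by (simp add: alternating_def)
  have g_tail: "multilinear m (\<lambda>t. g p (q # t))" for p q
    using alternating_tail[OF g] by (simp add: alternating_def)
  have g0: "g p v = 0 \<longleftrightarrow> W p v = 0" for p v using c0 by (simp add: g_def)
  have g_diag: "g p (p # t) = 0" if "length t = m" for p t
    using diag[OF that] by (simp add: g_def)
  have g_b: "g p (b # t) = - W b (p # t)" if "length t = m" for p t
    using c[OF that] by (simp add: g_def)
  \<comment> \<open>Both tail forms have the same zeros, hence a constant ratio \<open>d\<close>. At
    a tail \<open>s\<close> where \<open>W p (q # s)\<close>, \<open>W b (p # s)\<close> and
    \<open>W b (q # s)\<close> are all nonzero, the cocycle condition for \<open>p\<close>,
    \<open>q\<close>, \<open>b\<close> gives \<open>d = - 1\<close>. If \<open>W p (q # t)\<close>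
    vanishes for all \<open>t\<close>, both sides are 0.\<close>
  have anti: "g p (q # t) = - g q (p # t)" if p: "p \<notin> R" and q: "q \<notin> R" and t: "length t = m" for p q t
  proof -
    obtain d where d: "\<And>t. length t = m \<Longrightarrow> g p (q # t) = d * g q (p # t)"
      using multilinear_proportional[OF g_tail g_tail, of q p p q] sym g0 by blast
    show ?thesis
    proof (cases "\<exists>t. length t = m \<and> W p (q # t) \<noteq> 0")
      case False
      then have "W p (q # t) = 0" "W q (p # t) = 0" using t sym[OF t] by blast+
      then have "g p (q # t) = 0" "g q (p # t) = 0" using g0 by blast+
      then show ?thesis by simp
    next
      case True
      moreover have "\<exists>t. length t = m \<and> W b (p # t) \<noteq> 0" "\<exists>t. length t = m \<and> W b (q # t) \<noteq> 0"
        using p q by (auto simp: R_def)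
      ultimately obtain s where s: "length s = m" "W p (q # s) \<noteq> 0" "W b (p # s) \<noteq> 0" "W b (q # s) \<noteq> 0"
        using multilinear_common_nonzero[OF e ml_tail ml_tail ml_tail] by metis
      have "W p (q # s) * W q (b # s) * W b (p # s) = - (W q (p # s) * W b (q # s) * W p (b # s))"
        using three_cycle_identity[of "\<lambda>x y. W x (y # s)" p q b] lin diag sym s(1) by blast
      then have "g p (q # s) * g q (b # s) * W b (p # s) = - (g q (p # s) * W b (q # s) * g p (b # s))"
        unfolding g_def by (simp add: algebra_simps)
      then have "(g p (q # s) + g q (p # s)) * (W b (q # s) * W b (p # s)) = 0"
        by (simp add: g_b[OF s(1)] algebra_simps neg_eq_iff_add_eq_0)
      then have "g p (q # s) = - g q (p # s)"
        using s by (simp add: eq_neg_iff_add_eq_0)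
      then have "(d + 1) * g q (p # s) = 0" using d[OF s(1)] by (simp add: algebra_simps)
      then have "d = - 1" using s g0 sym by (simp add: eq_neg_iff_add_eq_0)
      then show ?thesis using d[OF t] by simp
    qed
  qed
  \<comment> \<open>For \<open>p\<close> in \<open>R\<close> the scalar carries no information, so
    \<open>G p\<close> gets the value that additivity forces, \<open>p + b\<^sub>1\<close> and
    \<open>b\<^sub>1\<close> being outside \<open>R\<close>.\<close>
  define G where "G p = (if p \<notin> R then g p else (\<lambda>v. g (p + b\<^sub>1) v - g b\<^sub>1 v))" for p
  have G: "alternating (Suc m) (G p)" for p
    using g[of p] alternating_diff[OF g[of "p + b\<^sub>1"] g[of b\<^sub>1]] by (simp add: G_def)
  have G_lin: "linear_form (\<lambda>x. G p (x # t))" if "length t = m" for p t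
    using multilinear_head[OF _ that] G by (simp add: alternating_def)
  \<comment> \<open>Here \<open>p\<close> may lie in \<open>R\<close>, since \<open>g r\<close> is
    additive. Linearity of \<open>G\<close> in \<open>p\<close> is thus that of \<open>g r\<close>;
    \<open>G_split\<close> reaches \<open>r\<close> in \<open>R\<close> as
    \<open>r + b\<^sub>1\<close> minus \<open>b\<^sub>1\<close>.\<close>
  have G_anti: "G p (r # t) = - g r (p # t)" if "r \<notin> R" "length t = m" for p r t
    using anti[of p r t] anti[of "p + b\<^sub>1" r t] anti[of b\<^sub>1 r t] that shift b\<^sub>1
    by (simp add: G_def linear_form_add[OF g_lin])
  have G_split: "G p (r # t) = - g (r + b\<^sub>1) (p # t) + g b\<^sub>1 (p # t)" if "r \<in> R" "length t = m" for p r t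
    using linear_form_add[OF G_lin[OF that(2)], of p r b\<^sub>1] that shift b\<^sub>1 by (simp add: G_anti)
  have G_head: "linear_form (\<lambda>p. G p v)" if len: "length v = Suc m" for v
  proof -
    obtain r t where v: "v = r # t" and t: "length t = m"
      using len by (auto simp: length_Suc_conv)
    show ?thesis
      unfolding linear_form_def v
      by (cases "r \<in> R")
        (simp_all add: G_anti G_split t linear_form_axpy[OF g_lin[OF t]] ring_distribs)
  qed
  have G_diag: "G p (p # t) = 0" if t: "length t = m" for p t
  proof (cases "p \<in> R")
    case False
    then show ?thesis using G_anti[OF False t, of p] g_diag[OF t] by simp
  next
    case True
    have "g (p + b\<^sub>1) (p # t) = - g (p + b\<^sub>1) (b\<^sub>1 # t)"
      using linear_form_add[OF g_lin[OF t], of "p + b\<^sub>1" p b\<^sub>1] g_diag[OF t, of "p + b\<^sub>1"]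
      by (simp add: eq_neg_iff_add_eq_0)
    also have "\<dots> = g b\<^sub>1 ((p + b\<^sub>1) # t)" using anti[OF shift[OF True] b\<^sub>1 t] by simp
    also have "\<dots> = g b\<^sub>1 (p # t)"
      using linear_form_add[OF g_lin[OF t], of b\<^sub>1 p b\<^sub>1] g_diag[OF t] by simp
    finally show ?thesis using G_split[OF True t, of p] by simp
  qed
  have zero: "Z (p # r # t) \<longleftrightarrow> G p (r # t) = 0" if t: "length t = m" for p r t
  proof -
    \<comment> \<open>Antisymmetry compares zeros for \<open>r\<close> outside \<open>R\<close>;
      both sides are linear forms in \<open>r\<close>, so agreement off a proper subspace extends to
      all \<open>r\<close>.\<close>
    have out: "W p (r # t) = 0 \<longleftrightarrow> G p (r # t) = 0" if "r \<notin> R" for r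
      using G_anti[OF that t, of p] g0[of r "p # t"] sym[OF t, of p r] by simp
    have "W p (r # t) = 0 \<longleftrightarrow> G p (r # t) = 0"
      using zeros_agree_outside_subspace[OF lin[OF t] G_lin[OF t] R b\<^sub>1, of p p r]
        zeros_agree_outside_subspace[OF G_lin[OF t] lin[OF t] R b\<^sub>1, of p p r] out by blast
    then show ?thesis using ZW[of "r # t" p] t by simp
  qed
  define w where "w v = G (hd v) (tl v)" for v
  have "alternating (Suc (Suc m)) w"
    by (rule alternating_Cons) (simp_all add: w_def G G_head G_diag)
  moreover have "Z v \<longleftrightarrow> w v = 0" if "length v = Suc (Suc m)" for v
    using that zero by (auto simp: w_def length_Suc_conv)
  ultimately show ?thesis by blast
qed

theorem alternating_zeros_imp_form:
  fixes Z :: "('a::field ^ 'n) list \<Rightarrow> bool"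
  assumes "alternating_zeros m Z"
  shows "\<exists>w. alternating m w \<and> (\<forall>v. length v = m \<longrightarrow> (Z v \<longleftrightarrow> w v = 0))"
\<comment> \<open>Over two elements the form is explicit. Otherwise the induction treats arities 0
  and 1 directly, because the step needs two slots.\<close>
proof (cases "\<exists>e::'a. e \<noteq> 0 \<and> e \<noteq> 1")
  case False
  then have "alternating m (\<lambda>v. if Z v then 0 else 1 :: 'a)"
    using alternating_zeros_two_element_field[OF assms] by blast
  then show ?thesis by (intro exI[of _ "\<lambda>v. if Z v then 0 else 1"]) simp
next
  case True
  then obtain e :: 'a where e: "e \<noteq> 0" "e \<noteq> 1" by blast
  show ?thesis
    using assms
  proof (induction m arbitrary: Z)
    case 0
    show ?case
      by (rule exI[of _ "\<lambda>v. if Z [] then 0 else 1"]) (simp add: alternating_def multilinear_def)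
  next
    case (Suc m)
    note IH = Suc.IH and prems = Suc.prems
    show ?case
    proof (cases m)
      case 0
      obtain f where f: "linear_form f" "\<And>x. Z ([] @ x # []) \<longleftrightarrow> f x = 0"
        by (rule alternating_zeros_slot[OF Suc.prems, of "[]" "[]"]) (simp_all add: 0)
      have "alternating (Suc m) (\<lambda>v. f (hd v))"
        using f(1) 0 by (simp add: alternating_def multilinear_def)
      moreover have "Z v \<longleftrightarrow> f (hd v) = 0" if "length v = Suc m" for v
      proof -
        have "v = [] @ hd v # []" using that 0 by (cases v) auto
        then show ?thesis using f(2)[of "hd v"] by metis
      qed
      ultimately show ?thesis by (intro exI[of _ "\<lambda>v. f (hd v)"]) simp
    next
      case (Suc k)
      have "\<exists>w. alternating m w \<and> (\<forall>v. length v = m \<longrightarrow> (Z (p # v) \<longleftrightarrow> w v = 0))" for p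
        by (rule IH[OF alternating_zeros_tail[OF prems]])
      then obtain W where W: "\<And>p. alternating m (W p)"
        and ZW: "\<And>p v. length v = m \<Longrightarrow> Z (p # v) \<longleftrightarrow> W p v = 0"
        by metis
      show ?thesis
      proof (cases "\<exists>b v. length v = m \<and> W b v \<noteq> 0")
        case True
        then obtain b where "\<exists>v. length v = Suc k \<and> W b v \<noteq> 0" using Suc by blast
        then show ?thesis
          using alternating_zeros_imp_form_step[OF e, of k Z W b] prems W ZW unfolding Suc by blast
      next
        case False
        then have "Z v" if "length v = Suc m" for v
          using that ZW by (auto simp: length_Suc_conv)
        then show ?thesis
          by (intro exI[of _ "\<lambda>v. 0"]) (simp add: alternating_def multilinear_def linear_form_def)
      qed
    qed
  qed
qed

section \<open>Subspaces and hyperplanes\<close>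

lemma span_append_singleton: "vec.span (set (us @ [x])) = vec.span (insert x (vec.span (set us)))"
  by (simp add: vec.span_insert vec.span_span)

lemma vsubsD: "U \<in> vsubs k \<Longrightarrow> vec.subspace U" "U \<in> vsubs k \<Longrightarrow> vec.dim U = k"
  by (simp_all add: vsubs_def)

lemma vsubs_eqI: "A \<in> vsubs k \<Longrightarrow> B \<in> vsubs k \<Longrightarrow> A \<subseteq> B \<Longrightarrow> A = B"
  using vec.subspace_dim_equal[of A B] by (simp add: vsubs_def)

lemma span_insert_in_vsubs: "U \<in> vsubs k \<Longrightarrow> x \<notin> U \<Longrightarrow> vec.span (insert x U) \<in> vsubs (Suc k)"
  by (simp add: vsubs_def vec.dim_insert vec.span_eq_iff[THEN iffD2])

lemma span_insert_eq_vsubs: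
  assumes "U \<in> vsubs k" "X \<in> vsubs (Suc k)" "U \<subseteq> X" "x \<in> X" "x \<notin> U"
  shows "vec.span (insert x U) = X"
  using assms by (intro vsubs_eqI[OF span_insert_in_vsubs] vec.span_minimal) (auto simp: vsubsD)

text \<open>Two distinct hyperplanes of \<open>X\<close> span \<open>X\<close>.\<close>

lemma vsubs_two_span:
  assumes "A \<in> vsubs k" "B \<in> vsubs k" "A \<noteq> B" "X \<in> vsubs (Suc k)" "A \<subseteq> X" "B \<subseteq> X"
    and "vec.subspace E" "A \<subseteq> E" "B \<subseteq> E"
  shows "X \<subseteq> E"
proof -
  obtain b where b: "b \<in> B" "b \<notin> A" using vsubs_eqI[of B k A] assms by blast
  then have "vec.span (insert b A) = X" using assms by (intro span_insert_eq_vsubs) auto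
  moreover have "vec.span (insert b A) \<subseteq> E" using b assms by (intro vec.span_minimal) auto
  ultimately show ?thesis by simp
qed

text \<open>The sum of \<open>A\<close> and \<open>B\<close> is all of \<open>X\<close>, so the
  dimension formula leaves \<open>k\<close> for the intersection.\<close>

lemma vsubs_Int:
  assumes "A \<in> vsubs (Suc k)" "B \<in> vsubs (Suc k)" "A \<noteq> B" "X \<in> vsubs (Suc (Suc k))" "A \<subseteq> X" "B \<subseteq> X"
  shows "A \<inter> B \<in> vsubs k"
proof -
  let ?S = "{x + y |x y. x \<in> A \<and> y \<in> B}"
  have sub: "vec.subspace A" "vec.subspace B" "vec.subspace X" using assms by (simp_all add: vsubsD)
  have S: "vec.subspace ?S" using sub by (intro vec.subspace_sums)
  have "A \<subseteq> ?S" "B \<subseteq> ?S"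
    using vec.subspace_0[OF sub(1)] vec.subspace_0[OF sub(2)] by force+
  then have "X \<subseteq> ?S" by (rule vsubs_two_span[OF assms S])
  moreover have "?S \<subseteq> X" using assms vec.subspace_add[OF sub(3)] by blast
  ultimately have "?S = X" by (rule antisym[rotated])
  then show ?thesis
    using vec.dim_sums_Int[OF sub(1,2)] sub assms by (auto simp: vsubs_def intro: vec.subspace_inter)
qed

lemma dim_less_imp_ex_notin:
  assumes "vec.subspace E" "vec.dim U < vec.dim (E :: ('a::field ^ 'n::finite) set)" "vec.subspace U"
  shows "\<exists>x\<in>E. x \<notin> U"
  using assms vec.dim_subset[of E U] by (meson not_less subsetI)

lemma dual_point_ex_notin:
  assumes "E \<in> (dual_points :: ('a::field ^ 'n::finite) set set)"
  shows "\<exists>x. x \<notin> E"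
proof -
  have "vec.dim E < vec.dim (UNIV :: ('a ^ 'n) set)"
    using assms zero_less_card_finite[where 'a='n] unfolding vec_dim_card
    by (simp add: dual_points_def vsubs_def pdim_def)
  then show ?thesis by (metis UNIV_eq_I less_irrefl)
qed

text \<open>For \<open>a\<close> outside \<open>E\<close>, \<open>f x\<close> is the coordinate of
  \<open>x\<close> along \<open>a\<close> modulo \<open>E\<close>: the unique scalar with
  \<open>x - f x *s a\<close> in \<open>E\<close>.\<close>

lemma dual_point_imp_kernel:
  assumes E: "E \<in> (dual_points :: ('a::field ^ 'n::finite) set set)"
  obtains f where "linear_form f" "\<And>x. x \<in> E \<longleftrightarrow> f x = 0"
proof -
  have sub: "vec.subspace E" using E by (simp add: dual_points_def vsubsD)
  obtain a where a: "a \<notin> E" using dual_point_ex_notin[OF E] by blast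
  have "vec.dim (insert a E) = CARD('n)"
    using E a zero_less_card_finite[where 'a='n]
    by (simp add: dual_points_def vsubs_def pdim_def vec.dim_insert vec.span_eq_iff[THEN iffD2])
  then have "vec.span (insert a E) = UNIV"
    using vec.subspace_dim_equal[of "vec.span (insert a E)" UNIV] by (simp add: card_cart_basis)
  then have "\<exists>k. x - k *s a \<in> E" for x
    using vec.span_breakdown_eq[of x a E] sub by (simp add: vec.span_eq_iff[THEN iffD2])
  then obtain f where f: "\<And>x. x - f x *s a \<in> E" by metis
  have uniq: "k = f x" if "x - k *s a \<in> E" for k x
  proof (rule ccontr)
    assume "k \<noteq> f x"
    have "(x - f x *s a) - (x - k *s a) \<in> E" using vec.subspace_diff[OF sub f that] .
    then have "(k - f x) *s a \<in> E" by (simp add: vec.scale_left_diff_distrib)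
    then have "inverse (k - f x) *s ((k - f x) *s a) \<in> E" by (rule vec.subspace_scale[OF sub])
    then show False using a \<open>k \<noteq> f x\<close> by (simp add: vector_smult_assoc del: vector_sub_rdistrib)
  qed
  have "linear_form f"
    unfolding linear_form_def
  proof (intro allI)
    fix c x y
    have "c *s (x - f x *s a) + (y - f y *s a) \<in> E"
      using f sub vec.subspace_add vec.subspace_scale by blast
    also have "c *s (x - f x *s a) + (y - f y *s a) = (c *s x + y) - (c * f x + f y) *s a"
      by (simp add: vec.scale_right_diff_distrib vec.scale_left_distrib)
    finally show "f (c *s x + y) = c * f x + f y" using uniq by metis
  qed
  moreover have "x \<in> E \<longleftrightarrow> f x = 0" for x
    using f[of x] uniq[of x 0] by auto
  ultimately show thesis by (rule that)
qed

lemma kernel_in_dual_points: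
  fixes f :: "'a::field ^ 'n::finite \<Rightarrow> 'a"
  assumes f: "linear_form f" and a: "f a \<noteq> 0"
  shows "{x. f x = 0} \<in> dual_points"
proof -
  let ?E = "{x. f x = 0}"
  have sub: "vec.subspace ?E" by (rule subspace_kernel[OF f])
  have "x \<in> vec.span (insert a ?E)" for x
    unfolding vec.span_breakdown_eq using a sub
    by (intro exI[of _ "f x / f a"]) (simp add: vec.span_eq_iff[THEN iffD2] linear_form_diff_scale[OF f])
  then have "vec.dim (vec.span (insert a ?E)) = CARD('n)"
    by (metis UNIV_eq_I vec_dim_card)
  then have "vec.dim ?E + 1 = CARD('n)"
    using a sub by (simp add: vec.dim_insert vec.span_eq_iff[THEN iffD2])
  then show ?thesis using sub by (simp add: dual_points_def vsubs_def pdim_def)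
qed

section \<open>Bases given as lists\<close>

lemma vsubs_basis_list:
  assumes "U \<in> vsubs k"
  obtains us where "length us = k" "vec.span (set us) = U"
proof -
  obtain B where B: "B \<subseteq> U" "vec.independent B" "U \<subseteq> vec.span B" "card B = vec.dim U"
    using vec.basis_exists by metis
  have "finite B" using B(2) by (rule vec.finiteI_independent)
  then obtain us where "set us = B" "distinct us" using finite_distinct_list by blast
  moreover have "vec.span B = U" using B assms by (intro vec.span_subspace) (auto simp: vsubsD)
  moreover have "card B = k" using B(4) assms by (simp add: vsubsD)
  ultimately show thesis using that[of us] distinct_card[of us] by simp
qed

text \<open>A list as long as the dimension of its span has no room for repetitions or dependencies.
  This recovers the injectivity and independence asked for in \<open>linear_complex\<close>.\<close>

lemma spanning_list_independent:
  assumes "vec.span (set us) \<in> vsubs (length us)"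
  shows "distinct us" "vec.independent (set us)"
proof -
  have "vec.dim (set us) = length us" using assms by (simp add: vsubs_def)
  moreover have "vec.dim (set us) \<le> card (set us)" by (rule vec.dim_le_card') simp
  ultimately have c: "card (set us) = length us" using card_length[of us] by simp
  then show "distinct us" by (rule card_distinct)
  show "vec.independent (set us)"
    using c assms by (intro vec.card_le_dim_spanning[of _ "vec.span (set us)"])
      (auto simp: vsubs_def vec.span_superset)
qed

section \<open>Linear complexes\<close>

lemma alternating_zero_move:
  assumes "alternating m w" "length xs + length us + length vs + 1 = m"
  shows "w (xs @ a # us @ vs) = 0 \<longleftrightarrow> w (xs @ us @ a # vs) = 0"
  using assms(2)
proof (induction us arbitrary: xs)
  case Nil
  then show ?case by simp
next
  case (Cons c us)
  have "w (xs @ a # [] @ c # us @ vs) = - w (xs @ c # [] @ a # us @ vs)"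
    using Cons.prems by (intro alternating_swap[OF assms(1)]) simp
  then show ?case using Cons.IH[of "xs @ [c]"] Cons.prems by simp
qed

text \<open>Swaps only change signs, so following the vanishing alone avoids signs of
  permutations.\<close>

lemma alternating_zero_perm:
  assumes "alternating m w" "length xs + length us = m" "mset us = mset vs"
  shows "w (xs @ us) = 0 \<longleftrightarrow> w (xs @ vs) = 0"
  using assms(2,3)
proof (induction us arbitrary: xs vs)
  case Nil
  then show ?case by simp
next
  case (Cons a us)
  then have "set (a # us) = set vs" by (metis set_mset_mset)
  then have "a \<in> set vs" by auto
  then obtain v\<^sub>1 v\<^sub>2 where vs: "vs = v\<^sub>1 @ a # v\<^sub>2" by (meson split_list)
  have ms: "mset us = mset (v\<^sub>1 @ v\<^sub>2)" using Cons.prems vs by simp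
  then have len: "length us = length (v\<^sub>1 @ v\<^sub>2)" by (rule mset_eq_length)
  have "w ((xs @ [a]) @ us) = 0 \<longleftrightarrow> w ((xs @ [a]) @ (v\<^sub>1 @ v\<^sub>2)) = 0"
    using Cons.prems ms by (intro Cons.IH) auto
  also have "\<dots> \<longleftrightarrow> w (xs @ v\<^sub>1 @ a # v\<^sub>2) = 0"
    using alternating_zero_move[OF assms(1), of xs v\<^sub>1 v\<^sub>2 a] Cons.prems len by simp
  finally show ?case by (simp add: vs)
qed

lemma alternating_not_distinct:
  assumes "alternating m w" "length us = m" "\<not> distinct us"
  shows "w us = 0"
proof -
  obtain xs ys zs x where "us = xs @ [x] @ ys @ [x] @ zs"
    using not_distinct_decomp[OF assms(3)] by blast
  then show ?thesis using assms(1,2) by (simp add: alternating_def)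
qed

text \<open>By linearity entries are replaced one at a time by vectors of \<open>vs\<close>; a tuple
  from \<open>vs\<close> has a repetition or is a permutation of \<open>vs\<close>. Hence vanishing
  on one basis of a subspace means vanishing on all, which justifies the existential in the
  definition of a complex.\<close>

lemma alternating_zero_on_span:
  assumes w: "alternating m w" and vs: "length vs = m" "w vs = 0"
    and us: "length us = m" "set us \<subseteq> vec.span (set vs)"
  shows "w us = 0"
proof -
  have base: "w ys = 0" if "length ys = m" "set ys \<subseteq> set vs" for ys
  proof (cases "distinct ys")
    case False
    then show ?thesis using alternating_not_distinct[OF w] that by blast
  next
    case True
    then have "card (set ys) = m" using that distinct_card by blast
    then have "set ys = set vs" "card (set vs) = m"
      using that vs card_mono[of "set vs" "set ys"] card_length[of vs] card_subset_eq[of "set vs" "set ys"]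
      by auto
    then have "distinct vs" using vs card_distinct by metis
    then have "mset ys = mset vs"
      using True \<open>set ys = set vs\<close> by (simp add: set_eq_iff_mset_eq_distinct)
    then show ?thesis using alternating_zero_perm[OF w, of "[]" ys vs] vs that by simp
  qed
  have "w (xs @ ys) = 0" if "length xs + length ys = m" "set xs \<subseteq> vec.span (set vs)" "set ys \<subseteq> set vs" for xs ys
    using that
  proof (induction xs arbitrary: ys rule: rev_induct)
    case Nil
    then show ?case using base by simp
  next
    case (snoc x xs)
    have "linear_form (\<lambda>x. w (xs @ x # ys))"
      using w snoc.prems by (simp add: alternating_def multilinear_def)
    then have "vec.subspace {x. w (xs @ x # ys) = 0}" by (rule subspace_kernel)
    moreover have "set vs \<subseteq> {x. w (xs @ x # ys) = 0}"
      using snoc.IH snoc.prems by auto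
    ultimately have "vec.span (set vs) \<subseteq> {x. w (xs @ x # ys) = 0}"
      by (intro vec.span_minimal)
    then show ?case using snoc.prems by auto
  qed
  from this[of us "[]"] show ?thesis using us by simp
qed

section \<open>Translation between forms on indexed families and forms on lists\<close>

lemma alt_form_imp_alternating:
  assumes w: "alt_form m w"
  shows "alternating m (\<lambda>vs. w (\<lambda>i. vs ! i))"
  unfolding alternating_def multilinear_def linear_form_def
proof (intro conjI allI impI)
  fix xs ys :: "('a ^ 'b) list" and c x y
  assume "length xs + length ys + 1 = m"
  then have i: "length xs < m" by simp
  \<comment> \<open>The 0 is a placeholder that the update overwrites.\<close>
  have upd: "(\<lambda>i. (xs @ z # ys) ! i) = (\<lambda>i. (xs @ 0 # ys) ! i)(length xs := z)" for z
    by (auto simp: nth_append fun_eq_iff nth_Cons')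
  have lin: "w (v(length xs := c *s x + y)) = c * w (v(length xs := x)) + w (v(length xs := y))" for v
    using w i unfolding alt_form_def by blast
  show "w (\<lambda>i. (xs @ (c *s x + y) # ys) ! i) = c * w (\<lambda>i. (xs @ x # ys) ! i) + w (\<lambda>i. (xs @ y # ys) ! i)"
    unfolding upd[of x] upd[of y] upd[of "c *s x + y"] by (rule lin)
next
  fix xs ys zs :: "('a ^ 'b) list" and x
  assume "length xs + length ys + length zs + 2 = m"
  moreover have rep: "w v = 0" if "i < m" "j < m" "i \<noteq> j" "v i = v j" for v i j
    using w that unfolding alt_form_def by blast
  moreover have "(xs @ x # ys @ x # zs) ! length xs = (xs @ x # ys @ x # zs) ! (length xs + length ys + 1)"
    by (simp add: nth_append)
  ultimately show "w (\<lambda>i. (xs @ x # ys @ x # zs) ! i) = 0"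
    using rep[of "length xs" "length xs + length ys + 1" "\<lambda>i. (xs @ x # ys @ x # zs) ! i"] by simp
qed

lemma alternating_imp_alt_form:
  assumes w: "alternating m w"
  shows "alt_form m (\<lambda>v. w (map v [0..<m]))"
  unfolding alt_form_def
proof (intro conjI allI impI)
  fix v u :: "nat \<Rightarrow> 'a ^ 'b"
  assume "\<forall>i<m. v i = u i"
  then have "map v [0..<m] = map u [0..<m]" by simp
  then show "w (map v [0..<m]) = w (map u [0..<m])" by (rule arg_cong)
next
  fix i c x y and v :: "nat \<Rightarrow> 'a ^ 'b"
  assume i: "i < m"
  have upd: "map (v(i := z)) [0..<m] = map v [0..<i] @ z # map v [Suc i..<m]" for z
  proof -
    have "[0..<m] = [0..<i] @ i # [Suc i..<m]"
      using i by (metis less_imp_add_positive upt_add_eq_append upt_conv_Cons zero_le)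
    then show ?thesis by simp
  qed
  have "linear_form (\<lambda>z. w (map v [0..<i] @ z # map v [Suc i..<m]))"
    using w i by (simp add: alternating_def multilinear_def)
  then show "w (map (v(i := c *s x + y)) [0..<m]) = c * w (map (v(i := x)) [0..<m]) + w (map (v(i := y)) [0..<m])"
    unfolding upd by (rule linear_form_axpy)
next
  fix v :: "nat \<Rightarrow> 'a ^ 'b" and i j
  assume "i < m \<and> j < m \<and> i \<noteq> j \<and> v i = v j"
  then have "\<not> distinct (map v [0..<m])" by (simp add: distinct_map inj_on_def) (metis atLeastLessThan_iff zero_le)
  then show "w (map v [0..<m]) = 0" using alternating_not_distinct[OF w] by simp
qed

lemma linear_complex_iff_alternating:
  "linear_complex h K \<longleftrightarrow>
     (\<exists>w. alternating (Suc h) w \<and> (\<exists>vs. length vs = Suc h \<and> w vs \<noteq> 0) \<and>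
        K = {X \<in> vsubs (Suc h). \<exists>vs. length vs = Suc h \<and> vec.span (set vs) = X \<and> w vs = 0})"
    (is "_ \<longleftrightarrow> (\<exists>w. ?alt w)")
proof
  assume "linear_complex h K"
  then obtain w v where w: "alt_form (Suc h) w" and v: "w v \<noteq> 0"
    and K: "K = {X \<in> vsubs (Suc h). \<exists>v. inj_on v {..<Suc h} \<and> vec.independent (v ` {..<Suc h}) \<and>
                 vec.span (v ` {..<Suc h}) = X \<and> w v = 0}"
    unfolding linear_complex_def by auto
  have nth: "w (\<lambda>i. map v [0..<Suc h] ! i) = w v" for v
  proof -
    have "\<forall>i<Suc h. map v [0..<Suc h] ! i = v i" by (simp add: nth_map_upt del: upt_Suc)
    then show ?thesis using w unfolding alt_form_def by blast
  qed
  have "?alt (\<lambda>vs. w (\<lambda>i. vs ! i))"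
  proof (intro conjI alt_form_imp_alternating[OF w])
    show "\<exists>vs. length vs = Suc h \<and> w (\<lambda>i. vs ! i) \<noteq> 0"
      using v nth[of v] by (intro exI[of _ "map v [0..<Suc h]"]) simp
    show "K = {X \<in> vsubs (Suc h). \<exists>vs. length vs = Suc h \<and> vec.span (set vs) = X \<and> w (\<lambda>i. vs ! i) = 0}"
    proof (intro set_eqI iffI)
      fix X assume "X \<in> K"
      then obtain v where "X \<in> vsubs (Suc h)" "vec.span (v ` {..<Suc h}) = X" "w v = 0"
        unfolding K by blast
      then show "X \<in> {X \<in> vsubs (Suc h). \<exists>vs. length vs = Suc h \<and> vec.span (set vs) = X \<and> w (\<lambda>i. vs ! i) = 0}"
        using nth[of v]
        by (auto intro!: exI[of _ "map v [0..<Suc h]"] simp: atLeast0LessThan simp del: upt_Suc)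
    next
      fix X assume "X \<in> {X \<in> vsubs (Suc h). \<exists>vs. length vs = Suc h \<and> vec.span (set vs) = X \<and> w (\<lambda>i. vs ! i) = 0}"
      then obtain vs where vs: "X \<in> vsubs (Suc h)" "length vs = Suc h" "vec.span (set vs) = X" "w (\<lambda>i. vs ! i) = 0"
        by blast
      have "distinct vs" "vec.independent (set vs)" using spanning_list_independent[of vs] vs by simp_all
      moreover have "(\<lambda>i. vs ! i) ` {..<Suc h} = set vs" using vs(2) by (auto simp: set_conv_nth)
      moreover have "inj_on (\<lambda>i. vs ! i) {..<Suc h}"
        using \<open>distinct vs\<close> vs(2) by (simp add: inj_on_def nth_eq_iff_index_eq)
      ultimately show "X \<in> K" unfolding K using vs by auto
    qed
  qed
  then show "\<exists>w. ?alt w" by blast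
next
  assume "\<exists>w. ?alt w"
  then obtain w u where w: "alternating (Suc h) w" and u: "length u = Suc h" "w u \<noteq> 0"
    and K: "K = {X \<in> vsubs (Suc h). \<exists>vs. length vs = Suc h \<and> vec.span (set vs) = X \<and> w vs = 0}"
    by blast
  let ?w = "\<lambda>v. w (map v [0..<Suc h])"
  have nth: "map (\<lambda>i. vs ! i) [0..<Suc h] = vs" if "length vs = Suc h" for vs :: "('a ^ 'b) list"
    using that by (metis map_nth)
  have "?w (\<lambda>i. u ! i) \<noteq> 0" unfolding nth[OF u(1)] by (rule u(2))
  moreover have "K = {X \<in> vsubs (Suc h). \<exists>v. inj_on v {..<Suc h} \<and> vec.independent (v ` {..<Suc h}) \<and>
                 vec.span (v ` {..<Suc h}) = X \<and> ?w v = 0}" (is "K = ?K")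
  proof (intro set_eqI iffI)
    fix X assume "X \<in> K"
    then obtain vs where vs: "X \<in> vsubs (Suc h)" "length vs = Suc h" "vec.span (set vs) = X" "w vs = 0"
      unfolding K by blast
    have "distinct vs" "vec.independent (set vs)" using spanning_list_independent[of vs] vs by simp_all
    moreover have "(\<lambda>i. vs ! i) ` {..<Suc h} = set vs" using vs(2) by (auto simp: set_conv_nth)
    moreover have "inj_on (\<lambda>i. vs ! i) {..<Suc h}"
      using \<open>distinct vs\<close> vs(2) by (simp add: inj_on_def nth_eq_iff_index_eq)
    moreover have "?w (\<lambda>i. vs ! i) = 0" unfolding nth[OF vs(2)] by (rule vs(4))
    ultimately show "X \<in> ?K" using vs by (intro CollectI conjI exI[of _ "\<lambda>i. vs ! i"]) simp_all
  next
    fix X assume "X \<in> ?K"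
    then obtain v where v: "X \<in> vsubs (Suc h)" "vec.span (v ` {..<Suc h}) = X" "?w v = 0" by blast
    have "set (map v [0..<Suc h]) = v ` {..<Suc h}" by (simp only: set_map set_upt atLeast0LessThan)
    then show "X \<in> K"
      unfolding K using v by (intro CollectI conjI exI[of _ "map v [0..<Suc h]"]) (simp_all del: upt_Suc)
  qed
  ultimately show "linear_complex h K"
    unfolding linear_complex_def Suc_eq_plus1[symmetric]
    using alternating_imp_alt_form[OF w] by blast
qed

section \<open>Polar hyperplanes and recovery of a complex from them\<close>

lemma polar_eqI:
  fixes E :: "('a::field ^ 'n::finite) set"
  assumes U: "U \<in> vsubs h" and h: "h < pdim TYPE('n)"
    and E: "E \<in> dual_points" "U \<subseteq> E"
    and K: "\<And>X. X \<in> vsubs (h + 1) \<Longrightarrow> U \<subseteq> X \<Longrightarrow> X \<in> K \<longleftrightarrow> X \<subseteq> E"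
  shows "polar h K U = E"
  unfolding polar_def
proof (rule the_equality)
  show "E \<in> dual_points \<and> (\<forall>X\<in>vsubs (h + 1). U \<subseteq> X \<longrightarrow> (X \<in> K) = (X \<subseteq> E))"
    using E K by blast
  fix E' assume E': "E' \<in> dual_points \<and> (\<forall>X\<in>vsubs (h + 1). U \<subseteq> X \<longrightarrow> (X \<in> K) = (X \<subseteq> E'))"
  have sub: "vec.subspace E" using E by (simp add: dual_points_def vsubsD)
  \<comment> \<open>The \<open>X\<close> through \<open>U\<close> inside \<open>E\<close> cover
    \<open>E\<close> and belong to \<open>K\<close>, which forces \<open>E\<close> into
    \<open>E'\<close>. The bound on \<open>h\<close> makes \<open>E\<close> larger than
    \<open>U\<close>, so at least one such \<open>X\<close> exists; it also puts \<open>U\<close>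
    into \<open>E'\<close>.\<close>
  have line: "x \<in> E'" "U \<subseteq> E'" if x: "x \<in> E" "x \<notin> U" for x
  proof -
    have X: "vec.span (insert x U) \<in> vsubs (h + 1)" using span_insert_in_vsubs[OF U x(2)] by simp
    have UX: "insert x U \<subseteq> vec.span (insert x U)" by (rule vec.span_superset)
    have "vec.span (insert x U) \<subseteq> E" using x E sub by (intro vec.span_minimal) auto
    then have "vec.span (insert x U) \<subseteq> E'" using E' K[OF X] X UX by blast
    then show "x \<in> E'" "U \<subseteq> E'" using UX by auto
  qed
  have "\<exists>x\<in>E. x \<notin> U"
    using dim_less_imp_ex_notin[OF sub, of U] U E h by (simp add: dual_points_def vsubs_def)
  then have "E \<subseteq> E'" using line by blast
  then show "E' = E" using vsubs_eqI[of E "pdim TYPE('n)" E'] E E' by (simp add: dual_points_def)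
qed

text \<open>For a basis \<open>us\<close> of \<open>U\<close> the polar hyperplane is the kernel of
  the linear form sending \<open>x\<close> to \<open>w (us @ [x])\<close>; non-singularity makes
  this form nonzero.\<close>

lemma linear_complex_polar:
  fixes K :: "('a::field ^ 'n::finite) set set"
  assumes "linear_complex h K" and h: "h < pdim TYPE('n)"
    and U: "U \<in> vsubs h" and ns: "\<not> singular h K U"
    and X: "X \<in> vsubs (h + 1)" "U \<subseteq> X"
  shows "X \<in> K \<longleftrightarrow> X \<subseteq> polar h K U"
proof -
  obtain w where w: "alternating (Suc h) w"
    and K: "K = {X \<in> vsubs (Suc h). \<exists>vs. length vs = Suc h \<and> vec.span (set vs) = X \<and> w vs = 0}"
    using assms(1) unfolding linear_complex_iff_alternating by blast
  obtain us where us: "length us = h" "vec.span (set us) = U" using vsubs_basis_list[OF U] .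
  define f where "f x = w (us @ [x])" for x
  have f: "linear_form f"
    using w us(1) unfolding f_def alternating_def multilinear_def by simp
  have sub: "vec.subspace {x. f x = 0}" by (rule subspace_kernel[OF f])
  have mem: "X \<in> K \<longleftrightarrow> X \<subseteq> {x. f x = 0}" if X: "X \<in> vsubs (Suc h)" "U \<subseteq> X" for X
  proof
    assume "X \<in> K"
    then obtain vs where vs: "length vs = Suc h" "vec.span (set vs) = X" "w vs = 0"
      unfolding K by blast
    have "f x = 0" if "x \<in> X" for x
      unfolding f_def using us vs X that vec.span_superset[of "set us"]
      by (intro alternating_zero_on_span[OF w vs(1,3)]) auto
    then show "X \<subseteq> {x. f x = 0}" by blast
  next
    assume "X \<subseteq> {x. f x = 0}"
    obtain x where x: "x \<in> X" "x \<notin> U"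
      using dim_less_imp_ex_notin[of X U] X(1) U by (auto simp: vsubs_def)
    have "vec.span (set (us @ [x])) = X"
      unfolding span_append_singleton us(2) by (rule span_insert_eq_vsubs[OF U X x])
    moreover have "w (us @ [x]) = 0" using x(1) \<open>X \<subseteq> _\<close> by (auto simp: f_def)
    ultimately show "X \<in> K" unfolding K using X(1) us(1)
      by (intro CollectI conjI exI[of _ "us @ [x]"]) simp_all
  qed
  obtain X' where "X' \<in> vsubs (Suc h)" "U \<subseteq> X'" "X' \<notin> K" using ns by (auto simp: singular_def)
  then obtain a where "f a \<noteq> 0" using mem by blast
  then have "{x. f x = 0} \<in> dual_points" by (rule kernel_in_dual_points[OF f])
  moreover have "set us \<subseteq> {x. f x = 0}"
    using us(1) alternating_not_distinct[OF w] by (auto simp: f_def)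
  then have "U \<subseteq> {x. f x = 0}" using vec.span_minimal[OF _ sub] us(2) by blast
  ultimately have "polar h K U = {x. f x = 0}" using mem by (intro polar_eqI[OF U h]) simp_all
  then show ?thesis using mem X by simp
qed

text \<open>Membership can be read off at any single \<open>U\<close> inside \<open>X\<close>, which
  yields uniqueness of the complex.\<close>

lemma linear_complex_mem_iff:
  fixes K :: "('a::field ^ 'n::finite) set set"
  assumes "linear_complex h K" "h < pdim TYPE('n)" "U \<in> vsubs h" "X \<in> vsubs (h + 1)" "U \<subseteq> X"
  shows "X \<in> K \<longleftrightarrow> (\<forall>E. up_complex h K U = Some E \<longrightarrow> X \<subseteq> E)"
  using assms linear_complex_polar[OF assms(1-3) _ assms(4,5)]
  by (auto simp: up_complex_def singular_def)

lemma up_complex_inject: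
  fixes K K' :: "('a::field ^ 'n::finite) set set"
  assumes "linear_complex h K" "linear_complex h K'" "h < pdim TYPE('n)"
    and "up_complex h K = up_complex h K'"
  shows "K = K'"
proof -
  have sub: "K \<subseteq> vsubs (h + 1)" "K' \<subseteq> vsubs (h + 1)"
    using assms(1,2) unfolding linear_complex_def by blast+
  have "X \<in> K \<longleftrightarrow> X \<in> K'" if X: "X \<in> vsubs (h + 1)" for X
  proof -
    have "h \<le> vec.dim X" using X by (simp add: vsubs_def)
    then obtain U where "vec.subspace U" "U \<subseteq> vec.span X" "vec.dim U = h"
      by (rule vec.choose_subspace_of_subspace)
    then have "U \<in> vsubs h" "U \<subseteq> X" using X by (simp_all add: vsubs_def vec.span_eq_iff[THEN iffD2])
    then show ?thesis
      using linear_complex_mem_iff[OF assms(1,3) _ X] linear_complex_mem_iff[OF assms(2,3) _ X] assms(4)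
      by simp
  qed
  then show ?thesis using sub by blast
qed

section \<open>Null linear mappings\<close>

text \<open>In the pencil through \<open>U\<close> and \<open>U'\<close> inside \<open>X\<close>,
  any two elements span \<open>X\<close>, and images contain their arguments. So the pencil can be
  neither exceptional nor contracted to a point, and if it is mapped bijectively onto a line, the
  image of \<open>U'\<close> cannot contain \<open>X\<close>.\<close>

lemma null_linear_mapping_dichotomy:
  fixes chi :: "('a::field ^ 'n::finite) set \<Rightarrow> ('a ^ 'n) set option"
  assumes h: "1 \<le> h" and lm: "linear_mapping h chi"
    and null: "\<forall>U \<in> dom chi. U \<subseteq> the (chi U)"
    and X: "X \<in> vsubs (h + 1)" and U: "U \<in> vsubs h" "U \<subseteq> X" and U': "U' \<in> vsubs h" "U' \<subseteq> X"
    and E: "chi U = Some E" "\<not> X \<subseteq> E"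
  shows "\<exists>E'. chi U' = Some E' \<and> \<not> X \<subseteq> E'"
proof (cases "U' = U")
  case True
  then show ?thesis using E by blast
next
  case False
  obtain k where hk: "h = Suc k" using h by (cases h) auto
  define T where "T = U \<inter> U'"
  have T: "T \<in> vsubs k"
    unfolding T_def using U U' X False hk by (intro vsubs_Int[of _ k _ X]) auto
  obtain u u' where u: "u \<in> U" "u \<notin> U'" and u': "u' \<in> U'" "u' \<notin> U"
    using vsubs_eqI[OF U(1) U'(1)] vsubs_eqI[OF U'(1) U(1)] False by blast
  have sub: "vec.subspace U" "vec.subspace U'" "vec.subspace X" using U U' X by (simp_all add: vsubsD)
  have out: "u + u' \<notin> U" "u + u' \<notin> U'"
    using vec.subspace_diff[OF sub(1), of "u + u'" u] vec.subspace_diff[OF sub(2), of "u + u'" u'] u u' by auto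
  \<comment> \<open>A third element of the pencil, available over every field because
    \<open>u + u'\<close> lies in neither \<open>U\<close> nor \<open>U'\<close>.\<close>
  define U'' where "U'' = vec.span (insert (u + u') T)"
  have U'': "U'' \<in> vsubs h" "U'' \<subseteq> X"
  proof -
    have "u + u' \<notin> T" using out by (simp add: T_def)
    then show "U'' \<in> vsubs h" unfolding U''_def hk by (rule span_insert_in_vsubs[OF T])
    have "u + u' \<in> X" using u u' U U' by (intro vec.subspace_add[OF sub(3)]) auto
    then show "U'' \<subseteq> X"
      unfolding U''_def using U by (intro vec.span_minimal[OF _ sub(3)]) (auto simp: T_def)
  qed
  have mem: "u + u' \<in> U''" "T \<subseteq> U''"
    using vec.span_superset[of "insert (u + u') T"] by (auto simp: U''_def)
  have ne: "U'' \<noteq> U" "U'' \<noteq> U'" using mem out by auto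
  define l where "l = pencil T X h"
  have l: "l \<in> grass_lines h"
    unfolding grass_lines_def l_def using T X U(2) by (auto simp: vsubs_def hk T_def)
  have pts: "U \<in> l" "U' \<in> l" "U'' \<in> l"
    using U U' U'' mem by (auto simp: l_def pencil_def T_def)
  have nullD: "vec.subspace F" "A \<subseteq> F" "F \<in> dual_points" if "chi A = Some F" for A F
  proof -
    show "F \<in> dual_points" using lm that by (auto simp: linear_mapping_def ran_def)
    then show "vec.subspace F" by (simp add: dual_points_def vsubsD)
    show "A \<subseteq> F" using null that by force
  qed
  have two: "X \<subseteq> F" if "A \<in> vsubs h" "B \<in> vsubs h" "A \<noteq> B" "A \<subseteq> X" "B \<subseteq> X" "vec.subspace F" "A \<subseteq> F" "B \<subseteq> F" for A B F
    using vsubs_two_span[of A h B X F] that X by simp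
  \<comment> \<open>A second element with image \<open>E\<close> would put two hyperplanes of
    \<open>X\<close>, hence \<open>X\<close>, into \<open>E\<close>.\<close>
  have same: False if "B \<in> vsubs h" "B \<subseteq> X" "B \<noteq> U" "chi B = Some E" for B
    using two[of U B E] that U E nullD by blast
  have "(pimage chi l \<in> dual_lines \<and> l \<subseteq> dom chi \<and> bij_betw (the \<circ> chi) l (pimage chi l)) \<or>
      (card (pimage chi l) = 1 \<and> card (l \<inter> (vsubs h - dom chi)) = 1) \<or> l \<subseteq> vsubs h - dom chi"
    using lm l unfolding linear_mapping_def Let_def by blast
  then consider
      (line) "pimage chi l \<in> dual_lines" "l \<subseteq> dom chi" "inj_on (the \<circ> chi) l"
    | (point) "card (pimage chi l) = 1" "card (l \<inter> (vsubs h - dom chi)) = 1"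
    | (exc) "l \<subseteq> vsubs h - dom chi"
    unfolding bij_betw_def by blast
  then show ?thesis
  proof cases
    case exc
    then show ?thesis using pts E by auto
  next
    case point
    have im: "F = E" if "A \<in> l" "chi A = Some F" for A F
    proof -
      have "F \<in> pimage chi l" "E \<in> pimage chi l" using that pts E by (auto simp: pimage_def)
      then show ?thesis using point(1) by (auto simp: card_1_singleton_iff)
    qed
    \<comment> \<open>With one exceptional element in the pencil, \<open>U'\<close> or
      \<open>U''\<close> has an image, and that image can only be \<open>E\<close>.\<close>
    have "U' \<in> dom chi \<or> U'' \<in> dom chi"
    proof (rule ccontr)
      assume "\<not> ?thesis"
      then have "U' \<in> l \<inter> (vsubs h - dom chi)" "U'' \<in> l \<inter> (vsubs h - dom chi)"
        using pts U' U'' by blast+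
      moreover obtain Y where "l \<inter> (vsubs h - dom chi) = {Y}" using point(2) by (rule card_1_singletonE)
      ultimately have "U' = Y" "U'' = Y" by (simp_all only: singleton_iff)
      then show False using ne(2) by simp
    qed
    then have False using im pts same U' U'' ne False by blast
    then show ?thesis ..
  next
    case line
    obtain E' E'' where E': "chi U' = Some E'" and E'': "chi U'' = Some E''" using line(2) pts by blast
    have dist: "E \<noteq> E'" "E' \<noteq> E''" using inj_onD[OF line(3), of U U'] inj_onD[OF line(3), of U' U'']
        pts E E' E'' False ne by auto
    obtain S where S: "vec.dim S = pdim TYPE('n) - 1" "vec.subspace S"
      and pen: "\<And>F. F \<in> pimage chi l \<Longrightarrow> S \<subseteq> F"
      using line(1) by (auto simp: dual_lines_def grass_lines_def pencil_def)
    have SE: "S \<subseteq> E" "S \<subseteq> E'" "S \<subseteq> E''" using pen pts E E' E'' by (auto simp: pimage_def)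
    \<comment> \<open>\<open>S\<close> is the axis of the pencil of images; distinct hyperplanes
      through it meet in nothing more.\<close>
    have Int: "A \<inter> B \<subseteq> S" if "A \<in> dual_points" "B \<in> dual_points" "A \<noteq> B" "S \<subseteq> A" "S \<subseteq> B"
      for A B :: "('a ^ 'n) set"
    proof -
      have AB: "vec.subspace (A \<inter> B)" using that by (auto simp: dual_points_def vsubs_def intro: vec.subspace_inter)
      have "vec.dim (A \<inter> B) \<noteq> pdim TYPE('n)"
      proof
        assume "vec.dim (A \<inter> B) = pdim TYPE('n)"
        then have "A \<inter> B \<in> vsubs (pdim TYPE('n))" using AB by (simp add: vsubs_def)
        then show False
          using vsubs_eqI[of "A \<inter> B" _ A] vsubs_eqI[of "A \<inter> B" _ B] that by (auto simp: dual_points_def)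
      qed
      moreover have "vec.dim (A \<inter> B) \<le> pdim TYPE('n)"
        using vec.dim_subset[of "A \<inter> B" A] that by (simp add: dual_points_def vsubs_def)
      ultimately have "vec.dim (A \<inter> B) \<le> vec.dim S" using S by simp
      then show ?thesis using vec.subspace_dim_equal[OF S(2) AB] that by blast
    qed
    \<comment> \<open>If \<open>X\<close> were in \<open>E'\<close>, then \<open>U\<close> would be
      in \<open>S\<close> and so in \<open>E''\<close>. Together with \<open>U''\<close> this puts
      \<open>X\<close> into \<open>E''\<close>, hence into \<open>S\<close>, hence into
      \<open>E\<close>.\<close>
    have "\<not> X \<subseteq> E'"
    proof
      assume XE': "X \<subseteq> E'"
      have "U \<subseteq> E \<inter> E'" using nullD(2)[OF E(1)] U(2) XE' by blast
      then have "U \<subseteq> S" using Int[OF nullD(3)[OF E(1)] nullD(3)[OF E'] dist(1) SE(1,2)] by blast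
      then have "U \<subseteq> E''" using SE by blast
      then have "X \<subseteq> E''"
        using two[OF U(1) U''(1)] ne U U'' nullD[OF E''] by blast
      then have "X \<subseteq> S" using Int[OF nullD(3)[OF E'] nullD(3)[OF E''] dist(2) SE(2,3)] XE' by blast
      then show False using SE E by blast
    qed
    then show ?thesis using E' by blast
  qed
qed

section \<open>The complex of a null linear mapping\<close>

theorem theorem5p6:
  fixes chi :: "('a::field ^ 'n::finite) set \<Rightarrow> ('a ^ 'n) set option"
    and h :: nat
  assumes "1 \<le> h" and "h \<le> pdim TYPE('n) - 1"
    and "linear_mapping h chi"
    and "dom chi \<noteq> {}"
    and "\<forall>U \<in> dom chi. U \<subseteq> the (chi U)"
  shows "\<exists>!K. linear_complex h K \<and> chi = up_complex h K"
proof (rule ex_ex1I)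
  have h: "h < pdim TYPE('n)" using assms(1,2) by simp
  show "K = K'" if "linear_complex h K \<and> chi = up_complex h K" "linear_complex h K' \<and> chi = up_complex h K'" for K K'
    using up_complex_inject[of h K K'] that h by simp
  note dich = null_linear_mapping_dichotomy[OF assms(1,3,5)]
  have domD: "U \<in> vsubs h" "E \<in> dual_points" "U \<subseteq> E" "vec.subspace E" if "chi U = Some E" for U E
  proof -
    show "U \<in> vsubs h" "E \<in> dual_points" using assms(3) that by (auto simp: linear_mapping_def ran_def)
    then show "vec.subspace E" by (simp add: dual_points_def vsubsD)
    show "U \<subseteq> E" using assms(5) that by force
  qed
  \<comment> \<open>\<open>B\<close> is the complement of the future \<open>K\<close>. It asks for
    some \<open>U\<close> in \<open>X\<close>; by the dichotomy \<open>BD\<close> turns this into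
    every \<open>U\<close> in \<open>X\<close>.\<close>
  define B where "B = {X \<in> vsubs (Suc h). \<exists>U E. U \<subseteq> X \<and> chi U = Some E \<and> \<not> X \<subseteq> E}"
  have B_sub: "B \<subseteq> vsubs (Suc h)" by (auto simp: B_def)
  have BD: "\<exists>E. chi U = Some E \<and> \<not> X \<subseteq> E" if "X \<in> B" "U \<in> vsubs h" "U \<subseteq> X" for X U
    using that dich[of X _ U] domD(1) unfolding B_def Suc_eq_plus1 by blast
  have B_iff: "X \<in> B \<longleftrightarrow> \<not> X \<subseteq> E" if "chi U = Some E" "X \<in> vsubs (Suc h)" "U \<subseteq> X" for X U E
  proof
    show "\<not> X \<subseteq> E" if "X \<in> B"
      using BD[OF that domD(1)[OF \<open>chi U = Some E\<close>] \<open>U \<subseteq> X\<close>] \<open>chi U = Some E\<close> by simp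
    show "X \<in> B" if "\<not> X \<subseteq> E"
      unfolding B_def using that \<open>chi U = Some E\<close> \<open>X \<in> vsubs (Suc h)\<close> \<open>U \<subseteq> X\<close> by blast
  qed
  have B_insert: "vec.span (insert x U) \<in> B" "vec.span (insert x U) \<in> vsubs (Suc h)"
    if "chi U = Some E" "x \<notin> E" for U E x
  proof -
    have "x \<notin> U" using domD(3)[OF that(1)] that(2) by blast
    then show *: "vec.span (insert x U) \<in> vsubs (Suc h)" using domD(1)[OF that(1)] by (rule span_insert_in_vsubs[rotated])
    show "vec.span (insert x U) \<in> B"
      using B_iff[OF that(1) *] vec.span_superset[of "insert x U"] that(2) by blast
  qed
  define K where "K = vsubs (Suc h) - B"
  have "alternating_zeros (Suc h) (\<lambda>vs. vec.span (set vs) \<notin> B)"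
    unfolding alternating_zeros_def
  proof (intro conjI allI impI)
    fix xs ys :: "('a ^ 'n) list"
    assume len: "length xs + length ys + 1 = Suc h"
    \<comment> \<open>The \<open>h\<close> fixed vectors span \<open>U\<close>. If
      \<open>chi U\<close> is a hyperplane, it is the kernel of the slot form; otherwise the slot
      form is zero.\<close>
    define U where "U = vec.span (set (xs @ ys))"
    have ins: "vec.span (set (xs @ x # ys)) = vec.span (insert x U)" for x
      using span_append_singleton[of "xs @ ys" x] by (simp add: U_def)
    show "\<exists>f. linear_form f \<and> (\<forall>x. vec.span (set (xs @ x # ys)) \<notin> B \<longleftrightarrow> f x = 0)"
    proof (cases "chi U")
      case (Some E)
      obtain f where f: "linear_form f" "\<And>x. x \<in> E \<longleftrightarrow> f x = 0"
        using dual_point_imp_kernel[OF domD(2)[OF Some]] by metis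
      have "vec.span (insert x U) \<notin> B \<longleftrightarrow> x \<in> E" for x
      proof
        show "x \<in> E" if "vec.span (insert x U) \<notin> B" using B_insert(1)[OF Some] that by blast
        assume "x \<in> E"
        then have "vec.span (insert x U) \<subseteq> E" using domD[OF Some] by (intro vec.span_minimal) auto
        \<comment> \<open>For \<open>x\<close> in \<open>U\<close> the span is too small to belong
          to \<open>B\<close>, which is covered by \<open>B_sub\<close>.\<close>
        then show "vec.span (insert x U) \<notin> B"
          using B_iff[OF Some, of "vec.span (insert x U)"] vec.span_superset[of "insert x U"] B_sub by blast
      qed
      then show ?thesis using f unfolding ins by metis
    next
      case None
      \<comment> \<open>Either \<open>U\<close> has dimension below \<open>h\<close>, and no span
        reaches \<open>h + 1\<close>, or \<open>U\<close> is exceptional and by \<open>BD\<close>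
        lies in no member of \<open>B\<close>.\<close>
      have "vec.span (insert x U) \<notin> B" for x
      proof
        assume XB: "vec.span (insert x U) \<in> B"
        then have "vec.dim (insert x U) = Suc h" by (auto simp: B_def vsubs_def)
        moreover have "vec.dim (set (xs @ ys)) \<le> card (set (xs @ ys))" by (rule vec.dim_le_card') simp
        then have "vec.dim U \<le> h" using len card_length[of "xs @ ys"] by (simp add: U_def)
        ultimately have "U \<in> vsubs h"
          by (auto simp: vsubs_def vec.dim_insert U_def vec.subspace_span split: if_splits)
        then show False using BD[OF XB, of U] None vec.span_superset[of "insert x U"] by simp
      qed
      then show ?thesis unfolding ins by (intro exI[of _ "\<lambda>_. 0"]) (simp add: linear_form_def)
    qed
  next
    fix xs ys zs :: "('a ^ 'n) list" and x
    assume len: "length xs + length ys + length zs + 2 = Suc h"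
    show "vec.span (set (xs @ x # ys @ x # zs)) \<notin> B"
    proof
      assume "vec.span (set (xs @ x # ys @ x # zs)) \<in> B"
      moreover have "length (xs @ x # ys @ x # zs) = Suc h" using len by simp
      ultimately have "vec.span (set (xs @ x # ys @ x # zs)) \<in> vsubs (length (xs @ x # ys @ x # zs))"
        using B_sub by (metis subsetD)
      then show False using spanning_list_independent(1) by fastforce
    qed
  qed
  then obtain w where w: "alternating (Suc h) w"
    and wB: "\<And>vs. length vs = Suc h \<Longrightarrow> vec.span (set vs) \<notin> B \<longleftrightarrow> w vs = 0"
    using alternating_zeros_imp_form by blast
  have "linear_complex h K"
    unfolding linear_complex_iff_alternating
  proof (intro exI[of _ w] conjI w)
    \<comment> \<open>The non-empty domain supplies a member of \<open>B\<close>, so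
      \<open>w\<close> is not the zero form.\<close>
    obtain U E where UE: "chi U = Some E" using assms(4) by blast
    obtain x where "x \<notin> E" using dual_point_ex_notin[OF domD(2)[OF UE]] by blast
    then have X: "vec.span (insert x U) \<in> B" "vec.span (insert x U) \<in> vsubs (Suc h)"
      using B_insert[OF UE] by blast+
    obtain vs where "length vs = Suc h" "vec.span (set vs) = vec.span (insert x U)"
      using vsubs_basis_list[OF X(2)] .
    then show "\<exists>vs. length vs = Suc h \<and> w vs \<noteq> 0" using wB X(1) by metis
    show "K = {X \<in> vsubs (Suc h). \<exists>vs. length vs = Suc h \<and> vec.span (set vs) = X \<and> w vs = 0}"
      unfolding K_def using wB vsubs_basis_list by (intro set_eqI iffI) (blast, blast)
  qed
  moreover have "chi U = up_complex h K U" for U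
  proof (cases "chi U")
    case None
    have "singular h K U" if "U \<in> vsubs h"
      unfolding singular_def K_def using BD[OF _ that] None by auto
    then show ?thesis using None by (simp add: up_complex_def)
  next
    case (Some E)
    obtain x where "x \<notin> E" using dual_point_ex_notin[OF domD(2)[OF Some]] by blast
    then have "\<not> singular h K U"
      using B_insert[OF Some] vec.span_superset[of "insert x U"] by (auto simp: singular_def K_def)
    moreover have "polar h K U = E"
      using B_iff[OF Some] by (intro polar_eqI domD[OF Some] h) (auto simp: K_def)
    ultimately show ?thesis using Some domD(1)[OF Some] by (simp add: up_complex_def)
  qed
  ultimately show "\<exists>K. linear_complex h K \<and> chi = up_complex h K" by blast
qed

end
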